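(* Algorithm \textsf{A} (defined below), run on an undirected graph with vertex set $[n]$, $n>1$, takes $O(\lg^2 n)$ steps.
   Context: Each edge $e$ has two ends $e.v,e.w$; the current edge set is initially the input edge set. Each vertex $v$ has a parent $v.p$, initially $v$. Vertices are compared as integers. Each operation is performed simultaneously for all edges/vertices using values at the start of the operation. \textsc{connect}: for each current edge $e$, send $\min\{e.v,e.w\}$ to $\max\{e.v,e.w\}$. \textsc{update}: for each vertex $v$, replace $v.p$ by the minimum of $v.p$ and the vertices sent to $v$ in the preceding \textsc{connect}. \textsc{shortcut}: for each vertex $v$, replace $v.p$ by $(v.p).p$. \textsc{alter}: for each edge $e$, let $x=e.v.p$, $y=e.w.p$; if $x=y$ delete $e$, else replace $e.v,e.w$ by $x,y$. Algorithm \textsf{A}: repeat \{\textsc{connect}; \textsc{update}; \textsc{shortcut}; \textsc{alter}\} until no parent changes. Each iteration is a round; a round consists of a constant number of synchronous concurrent message-passing steps, so the number of steps is within a constant factor of the number of rounds. $\lg$ is the base-two logarithm. *)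

theory Defs
  imports Complex_Main
begin

text \<open>
  Edges are objects with identity (indexed by natural numbers), so parallel edges are
  possible; these arise naturally, since altering edges can make two of them parallel.
\<close>

record state =
  edges :: "nat set"
  endv :: "nat \<Rightarrow> nat"
  endw :: "nat \<Rightarrow> nat"
  parent :: "nat \<Rightarrow> nat"

definition graph_on :: "nat \<Rightarrow> nat set \<Rightarrow> (nat \<Rightarrow> nat) \<Rightarrow> (nat \<Rightarrow> nat) \<Rightarrow> bool" where
  "graph_on n E ev ew \<longleftrightarrow> finite E \<and> (\<forall>e\<in>E. ev e \<in> {1..n} \<and> ew e \<in> {1..n})"

definition initial :: "nat set \<Rightarrow> (nat \<Rightarrow> nat) \<Rightarrow> (nat \<Rightarrow> nat) \<Rightarrow> state" where
  "initial E ev ew = \<lparr>edges = E, endv = ev, endw = ew, parent = (\<lambda>v. v)\<rparr>"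

text \<open>The set of vertices sent to \<open>u\<close>.\<close>

definition connect :: "state \<Rightarrow> nat \<Rightarrow> nat set" where
  "connect s u =
     {min (endv s e) (endw s e) | e. e \<in> edges s \<and> max (endv s e) (endw s e) = u}"

definition update :: "(nat \<Rightarrow> nat set) \<Rightarrow> state \<Rightarrow> state" where
  "update sent s = s\<lparr>parent := (\<lambda>u. Min (insert (parent s u) (sent u)))\<rparr>"

definition shortcut :: "state \<Rightarrow> state" where
  "shortcut s = s\<lparr>parent := (\<lambda>u. parent s (parent s u))\<rparr>"

text \<open>The recorded ends of deleted edges are irrelevant: no operation reads them.\<close>

definition alter :: "state \<Rightarrow> state" where
  "alter s = s\<lparr>edges := {e \<in> edges s. parent s (endv s e) \<noteq> parent s (endw s e)},
               endv := (\<lambda>e. parent s (endv s e)),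
               endw := (\<lambda>e. parent s (endw s e))\<rparr>"

definition a_round :: "state \<Rightarrow> state" where
  "a_round s = alter (shortcut (update (connect s) s))"

text \<open>
  Parents never increase, neither when updating nor when shortcutting, so a parent changes
  during a round iff its values before and after the round differ.
\<close>

definition parents_unchanged :: "nat \<Rightarrow> state \<Rightarrow> state \<Rightarrow> bool" where
  "parents_unchanged n s t \<longleftrightarrow> (\<forall>u\<in>{1..n}. parent t u = parent s u)"

text \<open>
  \<open>halts_after n s k\<close>: the repeat-until loop started in state \<open>s\<close> halts after executing
  exactly \<open>k\<close> rounds, including the final round in which no parent changes.
\<close>

inductive halts_after :: "nat \<Rightarrow> state \<Rightarrow> nat \<Rightarrow> bool" for n where
  stop: "parents_unchanged n s (a_round s) \<Longrightarrow> halts_after n s 1"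
| continue: "\<not> parents_unchanged n s (a_round s) \<Longrightarrow> halts_after n (a_round s) k \<Longrightarrow>
    halts_after n s (Suc k)"

lemma halts_after_unique: "halts_after n s k \<Longrightarrow> halts_after n s l \<Longrightarrow> k = l"
proof (induction arbitrary: l rule: halts_after.induct)
  case (stop s)
  from stop.prems show ?case using stop.hyps by cases blast+
next
  case (continue s k)
  from continue.prems show ?case using continue.hyps continue.IH by cases blast+
qed

text \<open>
  \<open>takes_steps c n E ev ew t\<close>: the algorithm, run on the given graph, halts after \<open>t\<close> steps,
  where \<open>c\<close> is the constant number of message-passing steps making up one round.
\<close>

definition takes_steps ::
  "nat \<Rightarrow> nat \<Rightarrow> nat set \<Rightarrow> (nat \<Rightarrow> nat) \<Rightarrow> (nat \<Rightarrow> nat) \<Rightarrow> nat \<Rightarrow> bool" where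
  "takes_steps c n E ev ew t \<longleftrightarrow> (\<exists>k. halts_after n (initial E ev ew) k \<and> t = c * k)"

end

theory Submission
  imports Defs
begin

text \<open>
  Let \<open>a\<close> map each vertex to its parent after \<open>update\<close>, so that a round replaces parents and
  edge ends by their images under \<open>a \<circ> a\<close>. Only vertices that are images under all rounds so
  far can be ends of edges, and among these the ones that are roots without edges and without
  children never matter again; let \<open>X\<close> be the set of the others. Give \<open>x \<in> X\<close> the weight
  \<open>K + 2\<close> if \<open>a x = x\<close> and \<open>K - lg (x - a x)\<close> otherwise, where \<open>K = 2 lg n + 8\<close>. Since the new
  jump length of \<open>x\<close> is at least the sum of the old jump lengths of \<open>x\<close> and \<open>a x\<close>, concavity of
  the logarithm bounds the new weight of \<open>x\<close> by the mean of the old weights of \<open>x\<close> and \<open>a x\<close>,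
  minus one. The exceptions are roots; a root without children becomes a nonroot in the next
  round, and the number of roots with children is at most the number of vertices leaving \<open>X\<close>.
  As the failure of injectivity of \<open>a\<close> is also bounded by the number of vertices leaving \<open>X\<close>,
  each round decreases the total weight by at least \<open>card X\<close>, that is, by a factor
  \<open>1 - \<Omega>(1 / lg n)\<close>. Hence \<open>X\<close> is empty after \<open>O(lg\<^sup>2 n)\<close> rounds, and \<open>O(lg n)\<close> further
  rounds flatten the trees.
\<close>

section \<open>The weight of a decreasing map\<close>

text \<open>The surplus 2 of a root, halved, offsets the 1 to be gained in
  \<open>weight_step\<close> by a child of a root, which has no second jump to add.\<close>

definition weight :: "real \<Rightarrow> (nat \<Rightarrow> nat) \<Rightarrow> nat \<Rightarrow> real" where
  "weight K a x = (if a x = x then K + 2 else K - log 2 (real x - real (a x)))"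

lemma weight_bounds:
  assumes "a x \<le> x" "x \<le> n" "n > 0"
  shows "K - log 2 (real n) \<le> weight K a x" "weight K a x \<le> K + 2"
proof -
  have "0 \<le> log 2 (real n)" using assms by simp
  moreover have "0 \<le> log 2 (real x - real (a x))" "log 2 (real x - real (a x)) \<le> log 2 (real n)"
    if "a x \<noteq> x"
  proof -
    have "real x - real (a x) \<ge> 1" using assms that by linarith
    then show "0 \<le> log 2 (real x - real (a x))" "log 2 (real x - real (a x)) \<le> log 2 (real n)"
      using assms by (auto simp: log_le_cancel_iff)
  qed
  ultimately show "K - log 2 (real n) \<le> weight K a x" "weight K a x \<le> K + 2"
    unfolding weight_def by fastforce+
qed

text \<open>AM-GM in the form \<open>4 * (u * v) \<le> (u + v)\<^sup>2\<close>, under the logarithm;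
  the 1 is half of \<open>log 2 4\<close>.\<close>

lemma log2_add_ge_mean:
  fixes u v :: real
  assumes "u > 0" "v > 0"
  shows "1 + (log 2 u + log 2 v) / 2 \<le> log 2 (u + v)"
proof -
  have "4 * (u * v) \<le> (u + v)\<^sup>2"
    using zero_le_power2[of "u - v"] by (simp add: power2_eq_square algebra_simps)
  then have "log 2 (4 * (u * v)) \<le> log 2 ((u + v)\<^sup>2)"
    using assms by (subst log_le_cancel_iff) auto
  moreover have "log 2 (4 * (u * v)) = 2 + (log 2 u + log 2 v)"
  proof -
    have "log 2 4 = (2::real)" using log_of_power_eq[of 4 2 2] by simp
    then show ?thesis using assms by (simp add: log_mult_pos)
  qed
  moreover have "log 2 ((u + v)\<^sup>2) = 2 * log 2 (u + v)"
    using assms by (simp add: log_nat_power)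
  ultimately show ?thesis by (simp add: field_simps)
qed

lemma weight_step:
  assumes "a x \<le> x" "a (a x) \<le> a x" "b x \<le> a (a x)" "a x = x \<Longrightarrow> b x < x"
  shows "weight K b x \<le> weight K a x / 2 + weight K a (a x) / 2 - 1"
proof (cases "a x = x")
  case True
  then have "real x - real (b x) \<ge> 1" using assms by fastforce
  then have "- 1 \<le> log 2 (real x - real (b x))"
    using zero_le_log_cancel_iff[of 2 "real x - real (b x)"] by linarith
  then show ?thesis using True assms(4) by (auto simp: weight_def)
next
  case False
  then have lt: "a x < x" using assms by simp
  have pos: "real x - real (a x) \<ge> 1" using lt by linarith
  have b: "b x < x" using assms lt by linarith
  show ?thesis
  proof (cases "a (a x) = a x")
    case True
    have "log 2 (real x - real (a x)) \<le> log 2 (real x - real (b x))"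
      using pos assms True by (subst log_le_cancel_iff) auto
    moreover have "0 \<le> log 2 (real x - real (a x))" using pos by simp
    ultimately have "log 2 (real x - real (a x)) \<le> 2 * log 2 (real x - real (b x))" by linarith
    then show ?thesis using True False b by (simp add: weight_def field_simps)
  next
    case False
    then have lt2: "a (a x) < a x" using assms by simp
    have "1 + (log 2 (real x - real (a x)) + log 2 (real (a x) - real (a (a x)))) / 2
        \<le> log 2 ((real x - real (a x)) + (real (a x) - real (a (a x))))"
      using lt lt2 by (intro log2_add_ge_mean) auto
    also have "\<dots> \<le> log 2 (real x - real (b x))"
      using assms lt lt2 by (subst log_le_cancel_iff) auto
    finally show ?thesis using lt lt2 b by (simp add: weight_def field_simps)
  qed
qed

section \<open>Collisions of a map on a finite set\<close>

text \<open>Keep one representative in \<open>B\<close> of each value of \<open>f\<close>; each of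
  the remaining elements of \<open>A\<close> contributes at most \<open>M\<close>.\<close>

lemma sum_comp_le_sum_image:
  fixes g :: "'b \<Rightarrow> real"
  assumes "finite A" "\<And>x. x \<in> A \<Longrightarrow> g (f x) \<le> M"
  shows "(\<Sum>x\<in>A. g (f x)) \<le> (\<Sum>y\<in>f ` A. g y) + M * (real (card A) - real (card (f ` A)))"
proof -
  obtain B where B: "B \<subseteq> A" "inj_on f B" "f ` A = f ` B"
    using subset_image_inj[of "f ` A" f A] by auto
  have "(\<Sum>x\<in>A. g (f x)) = (\<Sum>x\<in>B. g (f x)) + (\<Sum>x\<in>A - B. g (f x))"
    using sum.subset_diff[OF B(1) assms(1), of "\<lambda>x. g (f x)"] by simp
  moreover have "(\<Sum>x\<in>B. g (f x)) = (\<Sum>y\<in>f ` A. g y)"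
    using B by (simp add: sum.reindex)
  moreover have "(\<Sum>x\<in>A - B. g (f x)) \<le> real (card (A - B)) * M"
    using assms by (intro sum_bounded_above) auto
  moreover have "real (card (A - B)) = real (card A) - real (card (f ` A))"
    using B assms finite_subset[OF B(1) assms(1)]
    by (simp add: card_Diff_subset card_image card_mono of_nat_diff)
  ultimately show ?thesis by (simp add: mult.commute)
qed

text \<open>Each element of \<open>B - A\<close> adds at most one new value, so injectivity fails on
  a subset by no more than on the whole set.\<close>

lemma card_image_deficit_mono:
  assumes "finite B" "A \<subseteq> B"
  shows "card A + card (f ` B) \<le> card B + card (f ` A)"
proof -
  have "f ` B = f ` A \<union> f ` (B - A)" using assms by auto
  then have "card (f ` B) \<le> card (f ` A) + card (f ` (B - A))" by (simp add: card_Un_le)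
  also have "\<dots> \<le> card (f ` A) + card (B - A)"
    using assms by (simp add: card_image_le)
  finally show ?thesis
    using assms card_mono[OF assms] finite_subset[OF assms(2,1)] by (simp add: card_Diff_subset)
qed

text \<open>Such a root shares its value with a child, and the child is no fixed point, so removing
  all these roots leaves the image unchanged.\<close>

lemma card_nontrivial_roots:
  assumes "finite X"
  shows "card {x \<in> X. a x = x \<and> (\<exists>y\<in>X. y \<noteq> x \<and> a y = x)} + card (a ` X) \<le> card X"
proof -
  let ?R = "{x \<in> X. a x = x \<and> (\<exists>y\<in>X. y \<noteq> x \<and> a y = x)}"
  have "a ` X \<subseteq> a ` (X - ?R)"
  proof
    fix z assume "z \<in> a ` X"
    then obtain x where x: "x \<in> X" "z = a x" by blast
    show "z \<in> a ` (X - ?R)"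
    proof (cases "x \<in> ?R")
      case True
      then obtain y where "y \<in> X" "y \<noteq> x" "a y = x" "a x = x" by blast
      then have "y \<in> X - ?R" "z = a y" using x by auto
      then show ?thesis by blast
    qed (use x in blast)
  qed
  then have "card (a ` X) \<le> card (X - ?R)"
    using assms by (meson card_image_le card_mono finite_Diff finite_imageI le_trans)
  moreover have "card (X - ?R) = card X - card ?R" "card ?R \<le> card X"
    using assms by (auto intro!: card_Diff_subset card_mono)
  ultimately show ?thesis by linarith
qed

section \<open>The drop of the total weight in one round\<close>

text \<open>\<open>a\<close> and \<open>X\<close> are the current map and vertex set,
  \<open>b\<close> and \<open>Y\<close> the next ones. A vertex leaving \<open>X\<close> takes away
  at least \<open>W\<close> from each of the two averaged sums, which pays for the collisions of
  \<open>a\<close> and for the roots with children.\<close>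

lemma total_weight_decreases:
  fixes n :: nat and l :: real
  defines "l \<equiv> log 2 (real n)"
  defines "w \<equiv> weight (2 * l + 8)"
  assumes n: "n > 1" and X: "X \<subseteq> {1..n}" "a ` X \<subseteq> X"
    and le: "\<And>x. x \<in> X \<Longrightarrow> a x \<le> x"
    and Y: "Y \<subseteq> a ` a ` X"
    and b: "\<And>x. x \<in> Y \<Longrightarrow> b x \<le> a (a x)"
    and single: "\<And>x. x \<in> Y \<Longrightarrow> a x = x \<Longrightarrow> (\<And>y. y \<in> X \<Longrightarrow> a y = x \<Longrightarrow> y = x) \<Longrightarrow> b x < x"
  shows "(\<Sum>x\<in>Y. w b x) \<le> (\<Sum>x\<in>X. w a x) - real (card X)"
proof -
  define R where "R = {x \<in> X. a x = x \<and> (\<exists>y\<in>X. y \<noteq> x \<and> a y = x)}"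
  define W where "W = l + 8"
  define M where "M = 2 * l + 10"
  have l: "l \<ge> 0" using n by (simp add: l_def)
  have finX: "finite X" using X finite_subset by blast
  have YX: "Y \<subseteq> X" using Y image_mono[OF X(2), of a] X(2) by (rule order_trans[OF _ order_trans])
  have finY: "finite Y" using YX finX finite_subset by blast
  have W: "W \<le> w a x" and M: "w a x \<le> M" if "x \<in> X" for x
    using weight_bounds[of a x n "2 * l + 8"] that X le n
    by (auto simp: w_def W_def M_def l_def subset_iff)
  \<comment> \<open>A root with children may stay a root and is only known not to gain weight; the
    extra 1 accounts for it.\<close>
  have pointwise: "w b x \<le> w a x / 2 + w a (a x) / 2 - 1 + (if x \<in> R then 1 else 0)"
    if "x \<in> Y" for x
  proof (cases "x \<in> R")
    case True
    have "b x \<le> x" "a x = x" "x \<le> n" using b[OF that] True YX that X by (auto simp: R_def)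
    then show ?thesis using weight_bounds(2)[of b x n "2 * l + 8"] n True
      by (simp add: w_def weight_def)
  next
    case False
    have "b x < x" if "a x = x"
      using False single[OF \<open>x \<in> Y\<close> that] \<open>x \<in> Y\<close> YX that unfolding R_def by blast
    moreover have "x \<in> X" "a x \<in> X" using that YX X by auto
    ultimately show ?thesis using weight_step[of a x b] False le b[OF that] by (simp add: w_def)
  qed
  have lower: "(\<Sum>x\<in>A. w a x) \<le> (\<Sum>x\<in>X. w a x) - W * (real (card X) - real (card A))"
    if "A \<subseteq> X" for A
  proof -
    have "real (card (X - A)) * W \<le> (\<Sum>x\<in>X - A. w a x)"
      using W by (intro sum_bounded_below) auto
    moreover have "real (card (X - A)) = real (card X) - real (card A)"
      using that finX finite_subset[OF that finX]
      by (simp add: card_Diff_subset card_mono of_nat_diff)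
    ultimately show ?thesis using sum.subset_diff[OF that finX, of "w a"]
      by (simp add: mult.commute)
  qed
  have aY: "a ` Y \<subseteq> X" using image_mono[OF YX] X(2) by (rule order_trans)
  define N N' N'' where "N = real (card X)" and "N' = real (card Y)" and "N'' = real (card (a ` Y))"
  define S where "S = (\<Sum>x\<in>X. w a x)"
  have s1: "(\<Sum>x\<in>Y. w a x) \<le> S - W * (N - N')"
    using lower[OF YX] by (simp add: S_def N_def N'_def)
  \<comment> \<open>Repeated values of \<open>a\<close> on \<open>Y\<close> cost at most
    \<open>M\<close> each; elements of \<open>X\<close> that are not values save at least
    \<open>W\<close> each.\<close>
  have s2: "(\<Sum>x\<in>Y. w a (a x)) \<le> S - W * (N - N'') + M * (N' - N'')"
  proof -
    have "(\<Sum>x\<in>Y. w a (a x)) \<le> (\<Sum>y\<in>a ` Y. w a y) + M * (N' - N'')"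
      unfolding N'_def N''_def using M aY by (intro sum_comp_le_sum_image[OF finY]) blast
    then show ?thesis using lower[OF aY] by (simp add: S_def N_def N''_def)
  qed
  have "card Y \<le> card (a ` a ` X)" using Y finX by (simp add: card_mono)
  also have "\<dots> \<le> card (a ` X)" using finX by (simp add: card_image_le)
  finally have cY: "card Y \<le> card (a ` X)" .
  \<comment> \<open>Injectivity fails on \<open>Y\<close> by no more than on \<open>X\<close>, and
    there, by \<open>cY\<close>, by no more than the number of leaving vertices.\<close>
  have "card Y + card (a ` X) \<le> card X + card (a ` Y)"
    by (rule card_image_deficit_mono[OF finX YX])
  then have e: "N' - N'' \<le> N - N'" "0 \<le> N' - N''"
    using cY card_image_le[OF finY, of a] by (auto simp: N_def N'_def N''_def)
  have r: "real (card R) \<le> N - N'"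
    using card_nontrivial_roots[OF finX, of a] cY by (auto simp: N_def N'_def R_def)
  have "(\<Sum>x\<in>Y. w b x) \<le> (\<Sum>x\<in>Y. w a x / 2 + w a (a x) / 2 - 1 + (if x \<in> R then 1 else 0))"
    by (intro sum_mono pointwise)
  also have "\<dots> = (\<Sum>x\<in>Y. w a x) / 2 + (\<Sum>x\<in>Y. w a (a x)) / 2 - N' + real (card (Y \<inter> R))"
    using finY by (simp add: sum.distrib sum_subtractf sum_divide_distrib N'_def sum.If_cases)
  also have "real (card (Y \<inter> R)) \<le> real (card R)"
    using finX by (auto simp: R_def intro!: card_mono)
  finally have "(\<Sum>x\<in>Y. w b x) \<le> (\<Sum>x\<in>Y. w a x) / 2 + (\<Sum>x\<in>Y. w a (a x)) / 2 - N' + (N - N')"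
    using r by linarith
  also have "\<dots> \<le> (S - W * (N - N')) / 2 + (S - W * (N - N'') + M * (N' - N'')) / 2 - N' + (N - N')"
    using s1 s2 by (intro add_mono diff_mono divide_right_mono) auto
  \<comment> \<open>This uses \<open>M - W = l + 2\<close>; the first bound in \<open>e\<close>
    makes the last product nonnegative.\<close>
  also have "\<dots> = S - N - (l / 2 + 5) * (N - N') - (l / 2 + 1) * ((N - N') - (N' - N''))"
    by (simp add: W_def M_def field_simps)
  also have "\<dots> \<le> S - N"
  proof -
    have "0 \<le> (l / 2 + 5) * (N - N')" "0 \<le> (l / 2 + 1) * ((N - N') - (N' - N''))"
      using e l by (auto intro!: mult_nonneg_nonneg)
    then show ?thesis using e by linarith
  qed
  finally show ?thesis by (simp add: S_def N_def)
qed

section \<open>A round of the algorithm\<close>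

text \<open>The map called \<open>a\<close> in the overview; a round applies it twice.\<close>

definition hook :: "state \<Rightarrow> nat \<Rightarrow> nat" where
  "hook s u = Min (insert (parent s u) (connect s u))"

text \<open>Adjacency without edge identities. The input may have loops, so
  \<open>joined s x x\<close> can hold.\<close>

definition joined :: "state \<Rightarrow> nat \<Rightarrow> nat \<Rightarrow> bool" where
  "joined s x y \<longleftrightarrow> (\<exists>e\<in>edges s. (endv s e = x \<and> endw s e = y) \<or> (endv s e = y \<and> endw s e = x))"

lemma joined_sym: "joined s x y \<Longrightarrow> joined s y x"
  by (auto simp: joined_def)

lemma connect_eq: "connect s u = {y. y \<le> u \<and> joined s u y}"
proof -
  have "(min v w = y \<and> max v w = u) \<longleftrightarrow> y \<le> u \<and> (v = u \<and> w = y \<or> v = y \<and> w = u)" for v w y :: nat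
    by (auto simp: min_def max_def)
  then have "(\<exists>e. y = min (endv s e) (endw s e) \<and> e \<in> edges s \<and> max (endv s e) (endw s e) = u)
      \<longleftrightarrow> y \<le> u \<and> joined s u y" for y
    unfolding joined_def by (metis (no_types, lifting))
  then show ?thesis unfolding connect_def by simp
qed

lemma parent_a_round: "parent (a_round s) = hook s \<circ> hook s"
  by (simp add: a_round_def alter_def shortcut_def update_def hook_def fun_eq_iff)

lemma edges_a_round:
  "edges (a_round s) =
     {e \<in> edges s. hook s (hook s (endv s e)) \<noteq> hook s (hook s (endw s e))}"
  by (simp add: a_round_def alter_def shortcut_def update_def hook_def)

lemma ends_a_round:
  "endv (a_round s) e = hook s (hook s (endv s e))"
  "endw (a_round s) e = hook s (hook s (endw s e))"
  by (simp_all add: a_round_def alter_def shortcut_def update_def hook_def)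

lemma joined_a_round:
  "joined (a_round s) x y \<longleftrightarrow>
     x \<noteq> y \<and> (\<exists>v w. joined s v w \<and> hook s (hook s v) = x \<and> hook s (hook s w) = y)"
proof
  assume "joined (a_round s) x y"
  then show "x \<noteq> y \<and> (\<exists>v w. joined s v w \<and> hook s (hook s v) = x \<and> hook s (hook s w) = y)"
    unfolding joined_def edges_a_round ends_a_round by auto
next
  assume "x \<noteq> y \<and> (\<exists>v w. joined s v w \<and> hook s (hook s v) = x \<and> hook s (hook s w) = y)"
  then show "joined (a_round s) x y"
    unfolding joined_def edges_a_round ends_a_round by auto
qed

text \<open>\<open>V\<close> stands for the vertices that are images under all rounds so
  far.\<close>

definition run_inv :: "nat \<Rightarrow> state \<Rightarrow> nat set \<Rightarrow> bool" where
  "run_inv n s V \<longleftrightarrow> finite (edges s) \<and> V \<subseteq> {1..n} \<and> (\<forall>x y. joined s x y \<longrightarrow> x \<in> V) \<and>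
     (\<forall>v. parent s v \<le> v) \<and> parent s ` V \<subseteq> V"

lemma finite_connect: "finite (edges s) \<Longrightarrow> finite (connect s u)"
  by (simp add: connect_def)

lemma hook_le_parent: "finite (edges s) \<Longrightarrow> hook s u \<le> parent s u"
  by (simp add: hook_def finite_connect)

lemma hook_le_joined: "finite (edges s) \<Longrightarrow> joined s u y \<Longrightarrow> y \<le> u \<Longrightarrow> hook s u \<le> y"
  unfolding hook_def by (intro Min_le) (auto simp: finite_connect connect_eq)

lemma hook_cases:
  assumes "finite (edges s)"
  shows "hook s u = parent s u \<or> joined s u (hook s u)"
proof -
  have "hook s u \<in> insert (parent s u) (connect s u)"
    unfolding hook_def using assms by (intro Min_in) (auto simp: finite_connect)
  then show ?thesis by (auto simp: connect_eq)
qed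

lemma run_inv_hook:
  assumes "run_inv n s V"
  shows "hook s u \<le> u" "hook s ` V \<subseteq> V"
proof -
  show "hook s u \<le> u" using assms hook_le_parent[of s u] by (auto simp: run_inv_def intro: le_trans)
  show "hook s ` V \<subseteq> V"
  proof
    fix y assume "y \<in> hook s ` V"
    then obtain x where x: "x \<in> V" "y = hook s x" by blast
    from assms hook_cases have "hook s x = parent s x \<or> joined s x (hook s x)"
      by (auto simp: run_inv_def)
    then show "y \<in> V"
    proof
      assume "hook s x = parent s x"
      then show ?thesis using assms x by (auto simp: run_inv_def)
    next
      assume "joined s x (hook s x)"
      then have "joined s y x" using x joined_sym by simp
      then show ?thesis using assms by (auto simp: run_inv_def)
    qed
  qed
qed

lemma run_inv_a_round:
  assumes "run_inv n s V"
  shows "run_inv n (a_round s) (hook s ` hook s ` V)"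
  unfolding run_inv_def
proof (intro conjI allI impI)
  note h = run_inv_hook[OF assms]
  show "finite (edges (a_round s))" using assms by (simp add: run_inv_def edges_a_round)
  have "hook s ` hook s ` V \<subseteq> V" using h(2) by (auto simp: image_subset_iff)
  then show "hook s ` hook s ` V \<subseteq> {1..n}" using assms by (auto simp: run_inv_def)
  show "x \<in> hook s ` hook s ` V" if j: "joined (a_round s) x y" for x y
  proof -
    obtain v w where "joined s v w" "hook s (hook s v) = x"
      using j by (auto simp: joined_a_round)
    then show ?thesis using assms by (auto simp: run_inv_def)
  qed
  show "parent (a_round s) v \<le> v" for v
    using h(1)[of v] h(1)[of "hook s v"] by (simp add: parent_a_round)
  show "parent (a_round s) ` hook s ` hook s ` V \<subseteq> hook s ` hook s ` V"
    using h(2) by (auto simp: parent_a_round image_subset_iff)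
qed

section \<open>Isolated and active vertices\<close>

text \<open>Loops at \<open>x\<close> are allowed, as the next round deletes them. Children are
  sought only in \<open>V\<close>, since no other vertex can be an end of an edge again.\<close>

definition isolated :: "state \<Rightarrow> nat set \<Rightarrow> nat \<Rightarrow> bool" where
  "isolated s V x \<longleftrightarrow> hook s x = x \<and> (\<forall>y. joined s x y \<longrightarrow> y = x) \<and> (\<forall>y\<in>V. hook s y = x \<longrightarrow> y = x)"

definition active :: "state \<Rightarrow> nat set \<Rightarrow> nat set" where
  "active s V = {x \<in> V. \<not> isolated s V x}"

text \<open>In \<open>V\<close> only \<open>x\<close> is mapped to \<open>x\<close> by the round, so
  a later edge at \<open>x\<close> could only come from a loop, which \<open>alter\<close> deletes.
  Without edges at \<open>x\<close>, a later child in the new set would have been mapped to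
  \<open>x\<close> by this round already.\<close>

lemma isolated_a_round:
  assumes inv: "run_inv n s V" and iso: "isolated s V x"
  shows "isolated (a_round s) (hook s ` hook s ` V) x"
proof -
  let ?V = "hook s ` hook s ` V"
  have preimage: "v = x" if "hook s (hook s v) = x" "v \<in> V" for v
    using that iso run_inv_hook(2)[OF inv] by (auto simp: isolated_def image_subset_iff)
  have nj: "\<not> joined (a_round s) x y" for y
  proof
    assume "joined (a_round s) x y"
    then obtain v w where vw: "x \<noteq> y" "joined s v w" "hook s (hook s v) = x" "hook s (hook s w) = y"
      by (auto simp: joined_a_round)
    then have "v = x" using preimage inv by (auto simp: run_inv_def)
    then have "w = x" using vw iso by (auto simp: isolated_def)
    then show False using vw \<open>v = x\<close> by simp
  qed
  note inv' = run_inv_a_round[OF inv]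
  have fin: "finite (edges (a_round s))" using inv' by (simp add: run_inv_def)
  have "hook (a_round s) x = x"
    using hook_cases[OF fin, of x] nj iso by (auto simp: parent_a_round isolated_def)
  moreover have "y = x" if "y \<in> ?V" "hook (a_round s) y = x" for y
  proof -
    have "parent (a_round s) y = x"
      using hook_cases[OF fin, of y] that nj joined_sym by metis
    moreover have "y \<in> V" using that run_inv_hook(2)[OF inv] by (auto simp: image_subset_iff)
    ultimately show ?thesis using preimage by (simp add: parent_a_round)
  qed
  ultimately show ?thesis using nj by (auto simp: isolated_def)
qed

text \<open>An isolated vertex is its own image under the round and stays isolated, so an active
  image has only active preimages in \<open>V\<close>.\<close>

lemma active_a_round:
  assumes inv: "run_inv n s V"
  shows "active (a_round s) (hook s ` hook s ` V) \<subseteq> hook s ` hook s ` active s V"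
proof
  fix y assume y: "y \<in> active (a_round s) (hook s ` hook s ` V)"
  then obtain z where z: "z \<in> V" "y = hook s (hook s z)" by (auto simp: active_def)
  have "\<not> isolated s V z"
  proof
    assume iso: "isolated s V z"
    then have "y = z" using z by (simp add: isolated_def)
    then show False using y isolated_a_round[OF inv iso] by (simp add: active_def)
  qed
  then show "y \<in> hook s ` hook s ` active s V" using z by (auto simp: active_def)
qed

text \<open>An isolated vertex has no preimage in \<open>V\<close> but itself, so no active vertex
  hooks to it.\<close>

lemma hook_active:
  assumes "run_inv n s V"
  shows "hook s ` active s V \<subseteq> active s V"
proof
  fix y assume "y \<in> hook s ` active s V"
  then obtain x where x: "x \<in> V" "\<not> isolated s V x" "y = hook s x" by (auto simp: active_def)
  then have "y \<in> V" using run_inv_hook(2)[OF assms] by (auto simp: image_subset_iff)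
  moreover have "x = y" if "isolated s V y" using x that by (simp add: isolated_def)
  then have "\<not> isolated s V y" using x by blast
  ultimately show "y \<in> active s V" by (simp add: active_def)
qed

text \<open>
  All neighbours of a root without children prefer a smaller vertex, which becomes a neighbour
  of the root.
\<close>

lemma childless_root_hooks:
  assumes inv: "run_inv n s V" and x: "x \<in> active s V" "hook s x = x"
    and childless: "\<And>y. y \<in> active s V \<Longrightarrow> hook s y = x \<Longrightarrow> y = x"
  shows "hook (a_round s) x < x"
proof -
  have fin: "finite (edges s)" using inv by (simp add: run_inv_def)
  have childless': "y = x" if "y \<in> V" "hook s y = x" for y
  proof (cases "isolated s V y")
    case True
    then show ?thesis using that by (simp add: isolated_def)
  next
    case False
    then show ?thesis using that childless by (simp add: active_def)
  qed
  then obtain w where w: "joined s x w" "w \<noteq> x"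
    using x by (auto simp: active_def isolated_def)
  have wV: "w \<in> V" using inv joined_sym[OF w(1)] by (auto simp: run_inv_def)
  \<comment> \<open>The root \<open>x\<close> would have preferred a smaller neighbour. So
    \<open>w\<close> is sent \<open>x\<close> and, not being a child of \<open>x\<close>, hooks to
    something still smaller.\<close>
  have "x < w" using hook_le_joined[OF fin w(1)] w(2) x(2) by linarith
  then have "hook s w \<le> x" using hook_le_joined[OF fin joined_sym[OF w(1)]] by simp
  then have "hook s w < x" using childless'[OF wV] w(2) by fastforce
  then have lt: "hook s (hook s w) < x"
    using run_inv_hook(1)[OF inv, of "hook s w"] by simp
  have "joined (a_round s) x (hook s (hook s w))"
    unfolding joined_a_round
  proof (intro conjI exI)
    show "joined s x w" by (rule w(1))
    show "x \<noteq> hook s (hook s w)" using lt by simp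
  qed (simp_all add: x(2))
  moreover have "finite (edges (a_round s))" using fin by (simp add: edges_a_round)
  ultimately have "hook (a_round s) x \<le> hook s (hook s w)"
    using lt hook_le_joined[of "a_round s"] by simp
  then show ?thesis using lt by simp
qed

section \<open>The potential and its contraction\<close>

definition potential :: "nat \<Rightarrow> state \<Rightarrow> nat set \<Rightarrow> real" where
  "potential n s V = (\<Sum>x\<in>active s V. weight (2 * log 2 (real n) + 8) (hook s) x)"

lemma potential_a_round:
  assumes n: "n > 1" and inv: "run_inv n s V"
  shows "potential n (a_round s) (hook s ` hook s ` V) \<le> potential n s V - real (card (active s V))"
  unfolding potential_def
proof (rule total_weight_decreases[OF n])
  show "active s V \<subseteq> {1..n}" using inv by (auto simp: active_def run_inv_def)
  show "hook s ` active s V \<subseteq> active s V" by (rule hook_active[OF inv])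
  show "hook s x \<le> x" for x by (rule run_inv_hook(1)[OF inv])
  show sub: "active (a_round s) (hook s ` hook s ` V) \<subseteq> hook s ` hook s ` active s V"
    by (rule active_a_round[OF inv])
  show "hook (a_round s) x \<le> hook s (hook s x)" for x
    using hook_le_parent[of "a_round s" x] run_inv_a_round[OF inv]
    by (simp add: run_inv_def parent_a_round)
  show "hook (a_round s) x < x"
    if "x \<in> active (a_round s) (hook s ` hook s ` V)" "hook s x = x"
      "\<And>y. y \<in> active s V \<Longrightarrow> hook s y = x \<Longrightarrow> y = x" for x
  proof (rule childless_root_hooks[OF inv _ that(2,3)])
    show "x \<in> active s V" using that(1) sub hook_active[OF inv] by (auto simp: image_subset_iff subset_iff)
  qed
qed

text \<open>The lower bound later turns a small potential into an empty active set; the upper bound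
  turns the additive drop into a factor.\<close>

lemma potential_bounds:
  assumes n: "n > 1" and inv: "run_inv n s V"
  shows "(log 2 (real n) + 8) * real (card (active s V)) \<le> potential n s V"
    and "potential n s V \<le> (2 * log 2 (real n) + 10) * real (card (active s V))"
proof -
  let ?w = "weight (2 * log 2 (real n) + 8) (hook s)"
  have "log 2 (real n) + 8 \<le> ?w x \<and> ?w x \<le> 2 * log 2 (real n) + 10" if "x \<in> active s V" for x
    using weight_bounds[of "hook s" x n "2 * log 2 (real n) + 8"] run_inv_hook(1)[OF inv, of x] n that inv
    by (auto simp: active_def run_inv_def subset_iff)
  then show "(log 2 (real n) + 8) * real (card (active s V)) \<le> potential n s V"
    and "potential n s V \<le> (2 * log 2 (real n) + 10) * real (card (active s V))"
    using sum_bounded_below[of "active s V" "log 2 (real n) + 8" ?w]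
      sum_bounded_above[of "active s V" ?w "2 * log 2 (real n) + 10"]
    by (auto simp: potential_def mult.commute)
qed

lemma potential_contracts:
  assumes n: "n > 1" and inv: "run_inv n s V"
  shows "potential n (a_round s) (hook s ` hook s ` V)
    \<le> (1 - 1 / (12 * log 2 (real n))) * potential n s V"
proof -
  define l where "l = log 2 (real n)"
  have l: "l \<ge> 1" using n by (simp add: l_def)
  have "potential n s V \<le> (2 * l + 10) * real (card (active s V))"
    using potential_bounds(2)[OF n inv] by (simp add: l_def)
  \<comment> \<open>Since \<open>l \<ge> 1\<close>; this is the 12 of the contraction
    factor.\<close>
  also have "\<dots> \<le> (12 * l) * real (card (active s V))"
    using l by (intro mult_right_mono) auto
  finally have "potential n s V / (12 * l) \<le> real (card (active s V))"
    using l by (simp add: field_simps)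
  then show ?thesis using potential_a_round[OF n inv] by (simp add: l_def algebra_simps)
qed

section \<open>Counting rounds\<close>

lemma run_inv_iterate:
  assumes n: "n > 1" and inv: "run_inv n s V"
  shows "\<exists>W. run_inv n ((a_round ^^ t) s) W \<and>
    potential n ((a_round ^^ t) s) W \<le> (1 - 1 / (12 * log 2 (real n))) ^ t * potential n s V"
proof (induction t)
  case 0
  then show ?case using inv by auto
next
  case (Suc t)
  let ?c = "1 - 1 / (12 * log 2 (real n))"
  let ?s = "(a_round ^^ t) s"
  obtain W where W: "run_inv n ?s W" "potential n ?s W \<le> ?c ^ t * potential n s V"
    using Suc by blast
  have "1 \<le> log 2 (real n)" using n by simp
  then have "0 \<le> ?c" by (simp add: field_simps)
  then have "?c * potential n ?s W \<le> ?c * (?c ^ t * potential n s V)"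
    using W(2) by (intro mult_left_mono)
  then have "potential n (a_round ?s) (hook ?s ` hook ?s ` W) \<le> ?c ^ Suc t * potential n s V"
    using potential_contracts[OF n W(1)] by (simp add: mult.assoc)
  then show ?case using run_inv_a_round[OF W(1)]
    by (intro exI[of _ "hook ?s ` hook ?s ` W"]) simp
qed

lemma run_inv_initial:
  assumes "graph_on n E ev ew"
  shows "run_inv n (initial E ev ew) {1..n}"
  using assms by (auto simp: run_inv_def initial_def graph_on_def joined_def)

text \<open>The potential starts at no more than \<open>12 * l * real n\<close> and is multiplied by
  at most \<open>exp (- (5 * l))\<close>. As \<open>real n \<le> exp l\<close>, it ends below
  \<open>l + 8\<close>, a lower bound for the weight of any single active vertex.\<close>

lemma active_eventually_empty:
  assumes n: "n > 1" and g: "graph_on n E ev ew" and t: "60 * (log 2 (real n))\<^sup>2 \<le> real t"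
  shows "\<exists>W. run_inv n ((a_round ^^ t) (initial E ev ew)) W \<and>
    active ((a_round ^^ t) (initial E ev ew)) W = {}"
proof -
  define l where "l = log 2 (real n)"
  define s where "s = initial E ev ew"
  have l: "l \<ge> 1" using n by (simp add: l_def)
  have inv: "run_inv n s {1..n}" unfolding s_def by (rule run_inv_initial[OF g])
  obtain W where W: "run_inv n ((a_round ^^ t) s) W"
    and pot: "potential n ((a_round ^^ t) s) W \<le> (1 - 1 / (12 * l)) ^ t * potential n s {1..n}"
    using run_inv_iterate[OF n inv] unfolding l_def by blast
  let ?m = "card (active ((a_round ^^ t) s) W)"
  have "card (active s {1..n}) \<le> n"
    using card_mono[of "{1..n}" "active s {1..n}"] by (force simp: active_def)
  then have "(2 * l + 10) * real (card (active s {1..n})) \<le> (12 * l) * real n"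
    using l by (intro mult_mono) auto
  then have "potential n s {1..n} \<le> 12 * l * real n"
    using potential_bounds(2)[OF n inv] by (simp add: l_def)
  moreover have "0 \<le> potential n s {1..n}"
  proof -
    have "0 \<le> (l + 8) * real (card (active s {1..n}))" using l by simp
    then show ?thesis using potential_bounds(1)[OF n inv] by (simp add: l_def)
  qed
  moreover have "0 \<le> 1 - 1 / (12 * l)" using l by (simp add: field_simps)
  moreover from this have "(1 - 1 / (12 * l)) ^ t \<le> exp (- (real t / (12 * l)))"
  proof -
    have "1 - 1 / (12 * l) \<le> exp (- (1 / (12 * l)))"
      using exp_ge_add_one_self[of "- (1 / (12 * l))"] by simp
    then have "(1 - 1 / (12 * l)) ^ t \<le> exp (- (1 / (12 * l))) ^ t"
      using \<open>0 \<le> 1 - 1 / (12 * l)\<close> by (rule power_mono)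
    then show ?thesis by (simp flip: exp_of_nat_mult)
  qed
  \<comment> \<open>The 60 is 12 times 5, so \<open>real t / (12 * l)\<close> is at least
    \<open>5 * l\<close>.\<close>
  moreover have "exp (- (real t / (12 * l))) \<le> exp (- (5 * l))"
    using t l by (simp add: field_simps power2_eq_square l_def)
  ultimately have "(1 - 1 / (12 * l)) ^ t * potential n s {1..n} \<le> exp (- (5 * l)) * (12 * l * real n)"
    using l by (intro mult_mono') (auto intro: order_trans)
  also have "\<dots> < l + 8"
  proof -
    have "real n = exp (l * ln 2)" using n by (simp add: l_def log_def)
    also have "\<dots> \<le> exp l" using l ln_2_less_1 by (simp add: mult_left_le)
    finally have nl: "real n \<le> exp l" .
    \<comment> \<open>One factor \<open>exp l\<close> absorbs \<open>n\<close>; the remaining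
      \<open>exp (- (4 * l))\<close> is at most 1/16, enough against the 12.\<close>
    have "(2::real) ^ 4 \<le> (1 + l) ^ 4" using l by (intro power_mono) auto
    also have "\<dots> \<le> exp l ^ 4" using l by (intro power_mono) (auto simp: exp_ge_add_one_self)
    also have "\<dots> = exp (4 * l)" by (simp flip: exp_of_nat_mult)
    finally have "exp (- (4 * l)) \<le> 1 / 16" by (simp add: exp_minus field_simps)
    have "exp (- (5 * l)) * (12 * l * real n) \<le> exp (- (5 * l)) * (12 * l * exp l)"
      using nl l by (intro mult_left_mono) auto
    also have "\<dots> = exp (- (4 * l)) * (12 * l)" by (simp add: mult_exp_exp)
    also have "\<dots> \<le> 1 / 16 * (12 * l)"
      using \<open>exp (- (4 * l)) \<le> 1 / 16\<close> l by (intro mult_right_mono) auto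
    also have "\<dots> < l + 8" using l by simp
    finally show ?thesis .
  qed
  finally have "potential n ((a_round ^^ t) s) W < l + 8" using pot by simp
  then have "(l + 8) * real ?m < (l + 8) * 1"
    using potential_bounds(1)[OF n W] by (simp add: l_def)
  then have "real ?m < 1" using l by (subst (asm) mult_less_cancel_left_pos) auto
  then have "?m = 0" by simp
  moreover have "finite (active ((a_round ^^ t) s) W)"
    using W by (auto simp: active_def run_inv_def intro: finite_subset)
  ultimately show ?thesis using W unfolding s_def by auto
qed

section \<open>Flattening the trees\<close>

lemma joined_trivial_if_no_active:
  assumes "run_inv n s V" "active s V = {}" "joined s x y"
  shows "x = y"
  using assms by (auto simp: active_def run_inv_def isolated_def)

text \<open>Loops send a vertex only to itself, which changes no parent, so each round just squares
  the parent map.\<close>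

lemma parent_iterate_no_links:
  assumes "\<And>x y. joined s x y \<Longrightarrow> x = y" "finite (edges s)" "\<And>v. parent s v \<le> v"
  shows "parent ((a_round ^^ k) s) = parent s ^^ (2 ^ k)"
  using assms
proof (induction k arbitrary: s)
  case 0
  then show ?case by simp
next
  case (Suc k)
  have hook: "hook s u = parent s u" for u
    using hook_cases[OF Suc.prems(2), of u] hook_le_parent[OF Suc.prems(2), of u] Suc.prems(1,3)
    by (metis le_antisym)
  have p: "parent (a_round s) = parent s ^^ 2"
    by (simp add: parent_a_round hook fun_eq_iff numeral_2_eq_2)
  have "parent ((a_round ^^ k) (a_round s)) = parent (a_round s) ^^ (2 ^ k)"
  proof (rule Suc.IH)
    show "x = y" if "joined (a_round s) x y" for x y
      using that Suc.prems(1) unfolding joined_a_round by blast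
    show "finite (edges (a_round s))" using Suc.prems(2) by (simp add: edges_a_round)
    show "parent (a_round s) v \<le> v" for v
      using Suc.prems(3)[of v] Suc.prems(3)[of "parent s v"] by (simp add: p numeral_2_eq_2)
  qed
  then show ?case by (simp add: p funpow_mult funpow_swap1 mult.commute)
qed

text \<open>Before reaching a fixed point each iteration drops by at least 1; after
  \<open>m \<ge> v\<close> of them the value is a fixed point or 0, which is one too.\<close>

lemma funpow_decreasing_fixed:
  fixes p :: "nat \<Rightarrow> nat"
  assumes "\<And>v. p v \<le> v" "v \<le> m"
  shows "p ((p ^^ m) v) = (p ^^ m) v"
proof -
  have "p ((p ^^ m) v) = (p ^^ m) v \<or> (p ^^ m) v + m \<le> v" for m
  proof (induction m)
    case (Suc m)
    show ?case using Suc assms(1)[of "(p ^^ m) v"] by (cases "p ((p ^^ m) v) = (p ^^ m) v") auto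
  qed simp
  then consider "p ((p ^^ m) v) = (p ^^ m) v" | "(p ^^ m) v = 0" using assms(2) by fastforce
  then show ?thesis using assms(1)[of 0] by cases auto
qed

lemma funpow_fixed: "p x = x \<Longrightarrow> (p ^^ m) x = x"
  by (induction m) auto

text \<open>By then the parent map has been iterated at least \<open>n\<close> times, so every
  vertex points to a root and squaring again changes nothing.\<close>

lemma parents_unchanged_no_links:
  assumes "\<And>x y. joined s x y \<Longrightarrow> x = y" "finite (edges s)" "\<And>v. parent s v \<le> v" "n \<le> 2 ^ k"
  shows "parents_unchanged n ((a_round ^^ k) s) (a_round ((a_round ^^ k) s))"
  unfolding parents_unchanged_def
proof
  fix u assume "u \<in> {1..n}"
  then have fixed: "parent s ((parent s ^^ (2 ^ k)) u) = (parent s ^^ (2 ^ k)) u"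
    using assms by (intro funpow_decreasing_fixed) auto
  have "parent (a_round ((a_round ^^ k) s)) u = (parent s ^^ (2 ^ Suc k)) u"
    using parent_iterate_no_links[OF assms(1-3), of "Suc k"] by simp
  also have "\<dots> = (parent s ^^ (2 ^ k)) ((parent s ^^ (2 ^ k)) u)"
    by (simp add: mult_2 funpow_add)
  also have "\<dots> = parent ((a_round ^^ k) s) u"
    using fixed parent_iterate_no_links[OF assms(1-3), of k] by (simp add: funpow_fixed)
  finally show "parent (a_round ((a_round ^^ k) s)) u = parent ((a_round ^^ k) s) u" .
qed

text \<open>The loop stops at the first unchanged round, at the latest the one following
  \<open>j\<close> rounds; \<open>Suc j\<close> counts that round too.\<close>

lemma halts_after_bound:
  assumes "parents_unchanged n ((a_round ^^ j) s) (a_round ((a_round ^^ j) s))"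
  shows "\<exists>k\<le>Suc j. halts_after n s k"
  using assms
proof (induction j arbitrary: s)
  case 0
  then show ?case using halts_after.stop by fastforce
next
  case (Suc j)
  show ?case
  proof (cases "parents_unchanged n s (a_round s)")
    case True
    then show ?thesis using halts_after.stop by fastforce
  next
    case False
    have "\<exists>k\<le>Suc j. halts_after n (a_round s) k"
      using Suc.prems by (intro Suc.IH) (simp add: funpow_swap1)
    then show ?thesis using halts_after.continue[OF False] by (meson Suc_le_mono)
  qed
qed

theorem theorem13:
  fixes c :: nat
  shows "\<exists>C::real. \<forall>n>1. \<forall>E ev ew. graph_on n E ev ew \<longrightarrow>
    (\<exists>t. takes_steps c n E ev ew t \<and> real t \<le> C * (log 2 (real n))\<^sup>2)"
proof (intro exI[of _ "64 * real c"] allI impI)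
  fix n :: nat and E ev ew
  assume n: "n > 1" and g: "graph_on n E ev ew"
  define l where "l = log 2 (real n)"
  \<comment> \<open>\<open>t\<close> rounds empty the active set; \<open>k\<close> more give
    \<open>n \<le> 2 ^ k\<close> and flatten the trees.\<close>
  define t k where "t = nat \<lceil>60 * l\<^sup>2\<rceil>" and "k = nat \<lceil>l\<rceil>"
  define s where "s = (a_round ^^ t) (initial E ev ew)"
  have l: "l \<ge> 1" using n by (simp add: l_def)
  have t: "60 * l\<^sup>2 \<le> real t" "real t \<le> 60 * l\<^sup>2 + 1" unfolding t_def
    using of_nat_ceiling[of "60 * l\<^sup>2"] of_int_ceiling_le_add_one[of "60 * l\<^sup>2"] by (simp_all add: of_nat_nat)
  have k: "l \<le> real k" "real k \<le> l + 1" unfolding k_def using l by linarith+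
  obtain W where W: "run_inv n s W" "active s W = {}"
    using active_eventually_empty[OF n g] t(1) unfolding s_def l_def by blast
  have "real n = 2 powr l" using n by (simp add: l_def)
  also have "\<dots> \<le> 2 powr real k" using k by simp
  also have "\<dots> = real (2 ^ k)" by (simp add: powr_realpow)
  finally have "n \<le> 2 ^ k" unfolding of_nat_le_iff .
  then have "parents_unchanged n ((a_round ^^ k) s) (a_round ((a_round ^^ k) s))"
    using W joined_trivial_if_no_active[OF W] by (intro parents_unchanged_no_links) (auto simp: run_inv_def)
  then have "parents_unchanged n ((a_round ^^ (k + t)) (initial E ev ew))
      (a_round ((a_round ^^ (k + t)) (initial E ev ew)))"
    by (simp add: s_def funpow_add)
  then obtain r where r: "r \<le> Suc (k + t)" "halts_after n (initial E ev ew) r"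
    using halts_after_bound by blast
  have "l \<le> l\<^sup>2" "1 \<le> l\<^sup>2" using l self_le_power[of l 2] one_le_power[of l 2] by auto
  \<comment> \<open>The two ceilings and the final round add 1 each, so
    \<open>real r \<le> 60 * l\<^sup>2 + l + 3\<close>.\<close>
  then have "real r \<le> 64 * l\<^sup>2" using r(1) t(2) k(2) by linarith
  then have "real c * real r \<le> real c * (64 * l\<^sup>2)" by (rule mult_left_mono) simp
  then have "real (c * r) \<le> 64 * real c * l\<^sup>2" by (simp add: mult_ac)
  then show "\<exists>t. takes_steps c n E ev ew t \<and> real t \<le> 64 * real c * (log 2 (real n))\<^sup>2"
    using r(2) unfolding takes_steps_def l_def by blast
qed

end
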